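(* Let $n$ be odd and let $X=(X_{ij})$ be the $n\times n$ matrix of indeterminates. Then $AT(n)\cdot(R_n^{\mathrm{E}}-R_n^{\mathrm{O}})$ is the coefficient of $(-1)^{\frac{n(n-1)}{2}}\prod_{i=1}^n\prod_{j=1}^nX_{ij}$ in \[ \frac{1}{n!\,(n-1)!^2}\sum_{\substack{\rho,\sigma\in\mathrm{Sym}(n)^n\\ \rho_1=\mathrm{id}}}\epsilon(\sigma_1)\epsilon(\sigma)\epsilon(\rho)\prod_{i,j=1}^nX_{\sigma_i(j),\rho_j(i)}; \] that is, the coefficient of the monomial $\prod_{i,j}X_{ij}$ in this polynomial equals $(-1)^{\frac{n(n-1)}{2}}AT(n)(R_n^{\mathrm{E}}-R_n^{\mathrm{O}})$.
   Context: $\mathrm{Sym}(n)$ is the symmetric group on $[n]=\{1,\dots,n\}$ and $\epsilon(\pi)$ the sign of $\pi$. For $\sigma=(\sigma_1,\dots,\sigma_n)\in\mathrm{Sym}(n)^n$, $\sigma_1$ is its first component and $\epsilon(\sigma)=\prod_{i=1}^n\epsilon(\sigma_i)$ (similarly for $\rho$). A Latin square of order $n$ is an $n\times n$ array with entries in $[n]$ in which each number appears exactly once in each row and each column. Viewing rows and columns as permutations of $[n]$, the sign of a Latin square is the product of the signs of all its rows and all its columns; it is even if its sign is $1$ and odd if $-1$. A Latin square is normalized if its first row is the identity permutation, unipotent if all entries on its main diagonal are equal, and reduced if its first row and first column are the identity permutation. $AT(n)=U_n^{\mathrm{E}}-U_n^{\mathrm{O}}$, where $U_n^{\mathrm{E}}$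 ($U_n^{\mathrm{O}}$) is the number of normalized unipotent even (odd) Latin squares of order $n$; $R_n^{\mathrm{E}}$ ($R_n^{\mathrm{O}}$) is the number of even (odd) reduced Latin squares of order $n$. *)

theory Defs
  imports
    Complex_Main
    "HOL-Library.FuncSet"
    "HOL-Library.Poly_Mapping"
    "HOL-Combinatorics.Permutations"
begin

definition Sym :: "nat \<Rightarrow> (nat \<Rightarrow> nat) set"
  where "Sym n = {p. p permutes {1..n}}"

definition Sym_tuples :: "nat \<Rightarrow> (nat \<Rightarrow> nat \<Rightarrow> nat) set"
  where "Sym_tuples n = {1..n} \<rightarrow>\<^sub>E Sym n"

definition tuple_sign :: "nat \<Rightarrow> (nat \<Rightarrow> nat \<Rightarrow> nat) \<Rightarrow> int"
  where "tuple_sign n \<sigma> = (\<Prod>i\<in>{1..n}. sign (\<sigma> i))"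

text \<open>
  The entry of the array \<open>L\<close> in row \<open>i\<close> and column \<open>j\<close> is \<open>L (i, j)\<close>. Arrays are extensional
  functions (undefined outside the index set), so that cardinalities count actual arrays.
\<close>

definition latin_squares :: "nat \<Rightarrow> (nat \<times> nat \<Rightarrow> nat) set"
  where "latin_squares n = {L \<in> {1..n} \<times> {1..n} \<rightarrow>\<^sub>E {1..n}.
    (\<forall>i\<in>{1..n}. \<forall>k\<in>{1..n}. \<exists>!j. j \<in> {1..n} \<and> L (i, j) = k) \<and>
    (\<forall>j\<in>{1..n}. \<forall>k\<in>{1..n}. \<exists>!i. i \<in> {1..n} \<and> L (i, j) = k)}"

definition row_perm :: "nat \<Rightarrow> (nat \<times> nat \<Rightarrow> nat) \<Rightarrow> nat \<Rightarrow> nat \<Rightarrow> nat"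
  where "row_perm n L i = restrict_id (\<lambda>j. L (i, j)) {1..n}"

definition col_perm :: "nat \<Rightarrow> (nat \<times> nat \<Rightarrow> nat) \<Rightarrow> nat \<Rightarrow> nat \<Rightarrow> nat"
  where "col_perm n L j = restrict_id (\<lambda>i. L (i, j)) {1..n}"

definition latin_sign :: "nat \<Rightarrow> (nat \<times> nat \<Rightarrow> nat) \<Rightarrow> int"
  where "latin_sign n L =
    (\<Prod>i\<in>{1..n}. sign (row_perm n L i)) * (\<Prod>j\<in>{1..n}. sign (col_perm n L j))"

definition latin_even :: "nat \<Rightarrow> (nat \<times> nat \<Rightarrow> nat) \<Rightarrow> bool"
  where "latin_even n L \<longleftrightarrow> latin_sign n L = 1"

definition latin_odd :: "nat \<Rightarrow> (nat \<times> nat \<Rightarrow> nat) \<Rightarrow> bool"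
  where "latin_odd n L \<longleftrightarrow> latin_sign n L = -1"

definition normalized :: "nat \<Rightarrow> (nat \<times> nat \<Rightarrow> nat) \<Rightarrow> bool"
  where "normalized n L \<longleftrightarrow> row_perm n L 1 = id"

definition unipotent :: "nat \<Rightarrow> (nat \<times> nat \<Rightarrow> nat) \<Rightarrow> bool"
  where "unipotent n L \<longleftrightarrow> (\<forall>i\<in>{1..n}. \<forall>j\<in>{1..n}. L (i, i) = L (j, j))"

definition reduced :: "nat \<Rightarrow> (nat \<times> nat \<Rightarrow> nat) \<Rightarrow> bool"
  where "reduced n L \<longleftrightarrow> row_perm n L 1 = id \<and> col_perm n L 1 = id"

definition U_even :: "nat \<Rightarrow> nat"
  where "U_even n =
    card {L \<in> latin_squares n. normalized n L \<and> unipotent n L \<and> latin_even n L}"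

definition U_odd :: "nat \<Rightarrow> nat"
  where "U_odd n =
    card {L \<in> latin_squares n. normalized n L \<and> unipotent n L \<and> latin_odd n L}"

definition AT :: "nat \<Rightarrow> int"
  where "AT n = int (U_even n) - int (U_odd n)"

definition R_even :: "nat \<Rightarrow> nat"
  where "R_even n = card {L \<in> latin_squares n. reduced n L \<and> latin_even n L}"

definition R_odd :: "nat \<Rightarrow> nat"
  where "R_odd n = card {L \<in> latin_squares n. reduced n L \<and> latin_odd n L}"

text \<open>
  Polynomials in indeterminates indexed by \<open>'v\<close>: finitely supported maps from monomials, that is,
  finitely supported exponent vectors, to coefficients. The library's multiplication on such
  maps is convolution, which is the product of polynomials.
\<close>

type_synonym ('v, 'a) mpoly = "('v \<Rightarrow>\<^sub>0 nat) \<Rightarrow>\<^sub>0 'a"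

definition Const :: "'a \<Rightarrow> ('v, 'a::zero) mpoly"
  where "Const c = Poly_Mapping.single 0 c"

definition Var :: "'v \<Rightarrow> ('v, 'a::zero_neq_one) mpoly"
  where "Var v = Poly_Mapping.single (Poly_Mapping.single v 1) 1"

definition mcoeff :: "('v, 'a::zero) mpoly \<Rightarrow> ('v \<Rightarrow>\<^sub>0 nat) \<Rightarrow> 'a"
  where "mcoeff p m = Poly_Mapping.lookup p m"

text \<open>The exponent vector of the product of all \<open>X\<^sub>i\<^sub>j\<close> with \<open>1 \<le> i, j \<le> n\<close>.\<close>

definition all_ones_monomial :: "nat \<Rightarrow> (nat \<times> nat \<Rightarrow>\<^sub>0 nat)"
  where "all_ones_monomial n = (\<Sum>i\<in>{1..n}. \<Sum>j\<in>{1..n}. Poly_Mapping.single (i, j) 1)"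

end

theory Submission
  imports Defs
begin

text \<open>
  A pair \<open>(\<rho>, \<sigma>)\<close> contributes to the coefficient iff \<open>(i, j) \<mapsto> (\<sigma> i j, \<rho> j i)\<close> is a bijection
  of \<open>{1..n} \<times> {1..n}\<close>. If some column of \<open>\<sigma>\<close> other than the first has a repeated entry, the
  contributions for this \<open>\<sigma>\<close> cancel in pairs; since the rows of \<open>\<sigma>\<close> are permutations, what survives are
  the Latin squares \<open>L\<close>. For such an \<open>L\<close> with columns \<open>c j\<close>, the permutations \<open>\<rho> j \<circ> inv (c j)\<close> are
  the rows of a second Latin square \<open>M\<close> with first row \<open>inv (c 1)\<close>, and this is a bijection between the
  contributing \<open>\<rho>\<close> and such \<open>M\<close>. As \<open>n\<close> is odd, relabelling the symbols of \<open>M\<close> to normalize its first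
  row costs the factor \<open>sign (c 1)\<close>, so the sum factors as
  \<open>(\<Sum>L. sign (r 1) * sign (c 1) * latin_sign L) * (\<Sum>M normalized. row_sign M)\<close>, where \<open>r 1\<close> is the
  first row of \<open>L\<close>.

  The first factor is \<open>n! (n - 1)!\<close> times the signed count of reduced squares: relabel symbols, then
  permute the rows other than the first. For the second, exchange the roles of rows and symbols: \<open>M\<close> becomes a
  square \<open>N\<close> with constant diagonal \<open>1\<close>, and \<open>row_sign M\<close> becomes \<open>latin_sign N\<close> up to the sign
  \<open>(-1) ^ (n (n - 1) / 2)\<close> of the coordinate swap; relabelling the symbols other than \<open>1\<close> gives
  \<open>(n - 1)! AT(n)\<close>.
\<close>

section \<open>Signs of permutations of a product\<close>

lemma sign_power_odd: "odd k \<Longrightarrow> sign p ^ k = sign p"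
  by (cases p rule: sign_cases) auto

lemma sign_comp_permutes:
  "finite S \<Longrightarrow> p permutes S \<Longrightarrow> q permutes S \<Longrightarrow> sign (p \<circ> q) = sign p * sign q"
  by (intro sign_compose permutes_imp_permutation)

lemma sign_inv_permutes: "finite S \<Longrightarrow> p permutes S \<Longrightarrow> sign (inv p) = sign p"
  by (intro sign_inverse permutes_imp_permutation)

text \<open>Turns a family of permutations into a single permutation of pairs, acting in each fibre
  over \<open>A\<close> separately. A product of row or column signs thereby becomes one
  sign.\<close>

definition fibrewise :: "'a set \<Rightarrow> ('a \<Rightarrow> 'b \<Rightarrow> 'b) \<Rightarrow> 'a \<times> 'b \<Rightarrow> 'a \<times> 'b"
  where "fibrewise A f = (\<lambda>(i, j). if i \<in> A then (i, f i j) else (i, j))"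

text \<open>Induction on \<open>A\<close>: a new index \<open>a\<close> composes with a copy of
  \<open>f a\<close> transported along \<open>Pair a\<close>, and transport along an injection
  preserves signs.\<close>

lemma fibrewise_permutation_sign:
  assumes "finite A" "finite B" "\<And>i. i \<in> A \<Longrightarrow> f i permutes B"
  shows "permutation (fibrewise A f) \<and> sign (fibrewise A f) = (\<Prod>i\<in>A. sign (f i))"
  using assms(1,3)
proof (induction A rule: finite_induct)
  case empty
  have "fibrewise {} f = id"
    by (auto simp: fibrewise_def)
  then show ?case by simp
next
  case (insert a A)
  let ?q = "map_permutation B (Pair a) (f a)"
  have inj: "inj_on (Pair a) B"
    by (auto simp: inj_on_def)
  have fa: "f a permutes B"
    using insert.prems by simp
  have q: "?q permutes Pair a ` B"
    using fa inj by (intro map_permutation_permutes) (auto simp: bij_betw_def)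
  have app: "?q (i, j) = (if i = a then (i, f a j) else (i, j))" for i j
  proof (cases "i = a \<and> j \<in> B")
    case True
    then show ?thesis using map_permutation_apply[OF inj] by auto
  next
    case False
    then have "(i, j) \<notin> Pair a ` B" by auto
    with permutes_not_in[OF q] have "?q (i, j) = (i, j)" by blast
    moreover have "j \<notin> B \<Longrightarrow> f a j = j"
      using permutes_not_in[OF fa] by blast
    ultimately show ?thesis using False by auto
  qed
  have eq: "fibrewise (insert a A) f = ?q \<circ> fibrewise A f"
    using insert.hyps by (auto simp: fibrewise_def app fun_eq_iff)
  have pq: "permutation ?q"
    using q \<open>finite B\<close> permutes_imp_permutation by blast
  have IH: "permutation (fibrewise A f)" "sign (fibrewise A f) = (\<Prod>i\<in>A. sign (f i))"
    using insert by auto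
  have "sign ?q = sign (f a)"
    using inj fa \<open>finite B\<close> by (intro sign_map_permutation) auto
  then have "sign (?q \<circ> fibrewise A f) = (\<Prod>i\<in>insert a A. sign (f i))"
    using IH(2) insert.hyps by (simp add: sign_compose[OF pq IH(1)] del: o_apply)
  then show ?case
    unfolding eq using permutation_compose[OF pq IH(1)] by blast
qed

text \<open>The coordinate swap, cut down to \<open>A\<close> and its mirror image so that its
  support is finite when \<open>A\<close> is. For the pairs above the diagonal it transposes the
  whole square.\<close>

definition swap_on :: "('a \<times> 'a) set \<Rightarrow> 'a \<times> 'a \<Rightarrow> 'a \<times> 'a"
  where "swap_on A = (\<lambda>x. if x \<in> A \<or> prod.swap x \<in> A then prod.swap x else x)"

text \<open>Each \<open>x\<close> in \<open>A\<close> contributes one transposition with its mirror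
  image. The hypothesis excludes diagonal pairs and makes these transpositions disjoint.\<close>

lemma swap_on_permutation_sign:
  assumes "finite A" "\<And>x. x \<in> A \<Longrightarrow> prod.swap x \<notin> A"
  shows "permutation (swap_on A) \<and> sign (swap_on A) = (-1) ^ card A"
  using assms
proof (induction A rule: finite_induct)
  case empty
  have "swap_on ({} :: ('a \<times> 'a) set) = id"
    by (auto simp: swap_on_def)
  then show ?case by simp
next
  case (insert x A)
  have ne: "prod.swap x \<noteq> x" and nA: "prod.swap x \<notin> A"
    using insert.prems[of x] by auto
  have eq: "swap_on (insert x A) = transpose x (prod.swap x) \<circ> swap_on A"
  proof
    fix y
    have "prod.swap y = x \<longleftrightarrow> y = prod.swap x" "prod.swap y = prod.swap x \<longleftrightarrow> y = x"
      by (metis swap_swap)+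
    then show "swap_on (insert x A) y = (transpose x (prod.swap x) \<circ> swap_on A) y"
      using insert.hyps nA ne by (auto simp: swap_on_def transpose_def)
  qed
  have IH: "permutation (swap_on A)" "sign (swap_on A) = (-1) ^ card A"
    using insert.IH insert.prems by auto
  have "sign (transpose x (prod.swap x) \<circ> swap_on A) = (-1) ^ card (insert x A)"
    using IH(2) ne insert.hyps
    by (simp only: sign_compose[OF permutation_swap_id IH(1)]) (simp add: sign_swap_id)
  then show ?case
    unfolding eq using permutation_compose[OF permutation_swap_id IH(1)] by blast
qed

text \<open>The number of transpositions in the coordinate swap of the square, and so the source of
  the sign in the final formula.\<close>

lemma card_less_pairs:
  "card {(i, j). i \<in> {1..n} \<and> j \<in> {1..n} \<and> i < j} = n * (n - 1) div 2"
proof -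
  have "{(i, j). i \<in> {1..n} \<and> j \<in> {1..n} \<and> i < j} = prod.swap ` (SIGMA j:{1..n}. {1..<j})"
    by (auto simp: image_iff)
  then have *: "card {(i, j). i \<in> {1..n} \<and> j \<in> {1..n} \<and> i < j} = card (SIGMA j:{1..n}. {1..<j})"
    by (simp add: card_image)
  have "2 * (\<Sum>j\<in>{1..n}. j - 1) = n * (n - 1)"
  proof (induction n)
    case (Suc n)
    then show ?case by (cases n) (auto simp: algebra_simps)
  qed simp
  then have "(\<Sum>j\<in>{1..n}. j - 1) = n * (n - 1) div 2"
    by linarith
  with * show ?thesis by simp
qed

section \<open>Relabelling symbols and permuting rows of Latin squares\<close>

declare atLeastAtMost_iff [simp del] One_nat_def [simp del]

text \<open>The restriction matches the extensionality that \<open>latin_squares\<close>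
  demands.\<close>

definition array :: "nat \<Rightarrow> (nat \<Rightarrow> nat \<Rightarrow> nat) \<Rightarrow> nat \<times> nat \<Rightarrow> nat"
  where "array n f = restrict (\<lambda>(i, j). f i j) ({1..n} \<times> {1..n})"

definition relabel :: "nat \<Rightarrow> (nat \<Rightarrow> nat) \<Rightarrow> (nat \<times> nat \<Rightarrow> nat) \<Rightarrow> nat \<times> nat \<Rightarrow> nat"
  where "relabel n \<pi> L = array n (\<lambda>i j. \<pi> (L (i, j)))"

definition permute_rows :: "nat \<Rightarrow> (nat \<Rightarrow> nat) \<Rightarrow> (nat \<times> nat \<Rightarrow> nat) \<Rightarrow> nat \<times> nat \<Rightarrow> nat"
  where "permute_rows n \<alpha> L = array n (\<lambda>i j. L (\<alpha> i, j))"

definition row_sign :: "nat \<Rightarrow> (nat \<times> nat \<Rightarrow> nat) \<Rightarrow> int"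
  where "row_sign n L = (\<Prod>i\<in>{1..n}. sign (row_perm n L i))"

definition col_sign :: "nat \<Rightarrow> (nat \<times> nat \<Rightarrow> nat) \<Rightarrow> int"
  where "col_sign n L = (\<Prod>j\<in>{1..n}. sign (col_perm n L j))"

lemma latin_sign_eq: "latin_sign n L = row_sign n L * col_sign n L"
  by (simp add: latin_sign_def row_sign_def col_sign_def)

lemma array_apply [simp]: "i \<in> {1..n} \<Longrightarrow> j \<in> {1..n} \<Longrightarrow> array n f (i, j) = f i j"
  by (simp add: array_def)

lemma row_perm_apply: "j \<in> {1..n} \<Longrightarrow> row_perm n L i j = L (i, j)"
  by (simp add: row_perm_def)

lemma col_perm_apply: "i \<in> {1..n} \<Longrightarrow> col_perm n L j i = L (i, j)"
  by (simp add: col_perm_def)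

lemma row_perm_eqI:
  assumes "p permutes {1..n}" "\<And>j. j \<in> {1..n} \<Longrightarrow> L (i, j) = p j"
  shows "row_perm n L i = p"
  using assms permutes_not_in[OF assms(1)] by (auto simp: row_perm_def restrict_id_def fun_eq_iff)

lemma col_perm_eqI:
  assumes "p permutes {1..n}" "\<And>i. i \<in> {1..n} \<Longrightarrow> L (i, j) = p i"
  shows "col_perm n L j = p"
  using assms permutes_not_in[OF assms(1)] by (auto simp: col_perm_def restrict_id_def fun_eq_iff)

text \<open>Bridges the unique-occurrence conditions in \<open>latin_squares\<close> and bijectivity
  of rows and columns, the form used from here on.\<close>

lemma bij_betw_self_iff:
  "bij_betw f A A \<longleftrightarrow> f \<in> A \<rightarrow> A \<and> (\<forall>k\<in>A. \<exists>!j. j \<in> A \<and> f j = k)"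
proof
  assume "bij_betw f A A"
  then have inj: "inj_on f A" and im: "f ` A = A"
    by (auto simp: bij_betw_def)
  have "\<exists>!j. j \<in> A \<and> f j = k" if "k \<in> A" for k
  proof -
    from that have "k \<in> f ` A"
      by (simp only: im)
    then obtain j where "k = f j" "j \<in> A"
      by (rule imageE)
    with inj show ?thesis
      by (intro ex1I[of _ j]) (auto dest: inj_onD)
  qed
  moreover have "f \<in> A \<rightarrow> A"
    using im by auto
  ultimately show "f \<in> A \<rightarrow> A \<and> (\<forall>k\<in>A. \<exists>!j. j \<in> A \<and> f j = k)"
    by (intro conjI ballI)
next
  assume *: "f \<in> A \<rightarrow> A \<and> (\<forall>k\<in>A. \<exists>!j. j \<in> A \<and> f j = k)"
  show "bij_betw f A A"
    unfolding bij_betw_def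
  proof
    show "inj_on f A"
    proof (rule inj_onI)
      fix x y assume "x \<in> A" "y \<in> A" "f x = f y"
      moreover from this have "\<exists>!j. j \<in> A \<and> f j = f x"
        using * by auto
      ultimately show "x = y"
        by auto
    qed
    show "f ` A = A"
    proof
      show "A \<subseteq> f ` A"
        using * by fast
    qed (use * in auto)
  qed
qed

lemma latin_squares_iff:
  "L \<in> latin_squares n \<longleftrightarrow> L \<in> extensional ({1..n} \<times> {1..n}) \<and>
    (\<forall>i\<in>{1..n}. bij_betw (\<lambda>j. L (i, j)) {1..n} {1..n}) \<and>
    (\<forall>j\<in>{1..n}. bij_betw (\<lambda>i. L (i, j)) {1..n} {1..n})"
proof -
  let ?I = "{1..n}"
  \<comment> \<open>The range condition on the array can be read row by row or column by column, so
    it is absorbed into both families of bijections.\<close>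
  have 1: "L \<in> ?I \<times> ?I \<rightarrow> ?I \<longleftrightarrow> (\<forall>i\<in>?I. (\<lambda>j. L (i, j)) \<in> ?I \<rightarrow> ?I)"
    and 2: "L \<in> ?I \<times> ?I \<rightarrow> ?I \<longleftrightarrow> (\<forall>j\<in>?I. (\<lambda>i. L (i, j)) \<in> ?I \<rightarrow> ?I)"
    by auto
  show ?thesis
    unfolding bij_betw_self_iff ball_conj_distrib latin_squares_def PiE_def mem_Collect_eq Int_iff
      1[symmetric] 2[symmetric] by argo
qed

lemma row_perm_permutes: "L \<in> latin_squares n \<Longrightarrow> i \<in> {1..n} \<Longrightarrow> row_perm n L i permutes {1..n}"
  by (simp add: latin_squares_iff row_perm_def permutes_restrict_id)

lemma col_perm_permutes: "L \<in> latin_squares n \<Longrightarrow> j \<in> {1..n} \<Longrightarrow> col_perm n L j permutes {1..n}"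
  by (simp add: latin_squares_iff col_perm_def permutes_restrict_id)

lemma latin_in_range:
  "L \<in> latin_squares n \<Longrightarrow> i \<in> {1..n} \<Longrightarrow> j \<in> {1..n} \<Longrightarrow> L (i, j) \<in> {1..n}"
  by (auto simp: latin_squares_def PiE_iff)

lemma finite_latin_squares [simp]: "finite (latin_squares n)"
  by (rule finite_subset[of _ "{1..n} \<times> {1..n} \<rightarrow>\<^sub>E {1..n}"])
    (auto simp: latin_squares_def intro!: finite_PiE)

lemma array_latin:
  assumes "\<And>i. i \<in> {1..n} \<Longrightarrow> bij_betw (f i) {1..n} {1..n}"
    and "\<And>j. j \<in> {1..n} \<Longrightarrow> bij_betw (\<lambda>i. f i j) {1..n} {1..n}"
  shows "array n f \<in> latin_squares n"
proof -
  have "bij_betw (\<lambda>j. array n f (i, j)) {1..n} {1..n}" if "i \<in> {1..n}" for i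
    using assms(1)[OF that] that by (subst bij_betw_cong[where g = "f i"]) auto
  moreover have "bij_betw (\<lambda>i. array n f (i, j)) {1..n} {1..n}" if "j \<in> {1..n}" for j
    using assms(2)[OF that] that by (subst bij_betw_cong[where g = "\<lambda>i. f i j"]) auto
  ultimately show ?thesis
    by (auto simp: latin_squares_iff) (simp add: array_def)
qed

lemma latin_eqI:
  assumes "L \<in> latin_squares n" "M \<in> latin_squares n"
    and "\<And>i j. i \<in> {1..n} \<Longrightarrow> j \<in> {1..n} \<Longrightarrow> L (i, j) = M (i, j)"
  shows "L = M"
  using assms by (intro extensionalityI[of _ "{1..n} \<times> {1..n}"]) (auto simp: latin_squares_iff)

section \<open>Action of symbol permutations on Latin squares and their signs\<close>

lemma relabel_latin:
  assumes "L \<in> latin_squares n" "\<pi> permutes {1..n}"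
  shows "relabel n \<pi> L \<in> latin_squares n"
proof -
  have "bij_betw (\<lambda>j. \<pi> (L (i, j))) {1..n} {1..n}" if "i \<in> {1..n}" for i
    using bij_betw_trans[OF _ permutes_imp_bij[OF assms(2)], of "\<lambda>j. L (i, j)"] assms(1) that
    by (simp add: latin_squares_iff o_def)
  moreover have "bij_betw (\<lambda>i. \<pi> (L (i, j))) {1..n} {1..n}" if "j \<in> {1..n}" for j
    using bij_betw_trans[OF _ permutes_imp_bij[OF assms(2)], of "\<lambda>i. L (i, j)"] assms(1) that
    by (simp add: latin_squares_iff o_def)
  ultimately show ?thesis
    unfolding relabel_def by (rule array_latin)
qed

lemma row_perm_relabel:
  assumes "L \<in> latin_squares n" "\<pi> permutes {1..n}" "i \<in> {1..n}"
  shows "row_perm n (relabel n \<pi> L) i = \<pi> \<circ> row_perm n L i"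
  using assms
  by (intro row_perm_eqI permutes_compose row_perm_permutes) (auto simp: relabel_def row_perm_apply)

lemma col_perm_relabel:
  assumes "L \<in> latin_squares n" "\<pi> permutes {1..n}" "j \<in> {1..n}"
  shows "col_perm n (relabel n \<pi> L) j = \<pi> \<circ> col_perm n L j"
  using assms
  by (intro col_perm_eqI permutes_compose col_perm_permutes) (auto simp: relabel_def col_perm_apply)

lemma relabel_relabel_inv:
  assumes "L \<in> latin_squares n" "\<pi> permutes {1..n}"
  shows "relabel n \<pi> (relabel n (inv \<pi>) L) = L" "relabel n (inv \<pi>) (relabel n \<pi> L) = L"
  using assms permutes_inv[OF assms(2)] permutes_inverses[OF assms(2)]
  by (intro latin_eqI[of _ n] relabel_latin; auto simp: relabel_def)+

lemma row_sign_relabel: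
  assumes "L \<in> latin_squares n" "\<pi> permutes {1..n}"
  shows "row_sign n (relabel n \<pi> L) = sign \<pi> ^ n * row_sign n L"
proof -
  have "row_sign n (relabel n \<pi> L) = (\<Prod>i\<in>{1..n}. sign \<pi> * sign (row_perm n L i))"
    unfolding row_sign_def using assms
    by (intro prod.cong refl) (simp add: row_perm_relabel sign_comp_permutes[of "{1..n}"] row_perm_permutes)
  then show ?thesis by (simp add: prod.distrib row_sign_def)
qed

lemma col_sign_relabel:
  assumes "L \<in> latin_squares n" "\<pi> permutes {1..n}"
  shows "col_sign n (relabel n \<pi> L) = sign \<pi> ^ n * col_sign n L"
proof -
  have "col_sign n (relabel n \<pi> L) = (\<Prod>j\<in>{1..n}. sign \<pi> * sign (col_perm n L j))"
    unfolding col_sign_def using assms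
    by (intro prod.cong refl) (simp add: col_perm_relabel sign_comp_permutes[of "{1..n}"] col_perm_permutes)
  then show ?thesis by (simp add: prod.distrib col_sign_def)
qed

text \<open>Rows and columns contribute the same factor \<open>sign \<pi> ^ n\<close>, whose square
  is \<open>1\<close>.\<close>

lemma latin_sign_relabel:
  assumes "L \<in> latin_squares n" "\<pi> permutes {1..n}"
  shows "latin_sign n (relabel n \<pi> L) = latin_sign n L"
proof -
  have "sign \<pi> ^ n * sign \<pi> ^ n = 1"
    by (simp flip: power_mult_distrib)
  then show ?thesis
    using assms by (simp add: latin_sign_eq row_sign_relabel col_sign_relabel mult.commute mult.left_commute)
qed

section \<open>Action of row permutations on Latin squares and their signs\<close>

lemma permute_rows_latin:
  assumes "L \<in> latin_squares n" "\<alpha> permutes {1..n}"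
  shows "permute_rows n \<alpha> L \<in> latin_squares n"
  unfolding permute_rows_def
proof (intro array_latin)
  fix i assume "i \<in> {1..n}"
  then show "bij_betw (\<lambda>j. L (\<alpha> i, j)) {1..n} {1..n}"
    using assms permutes_in_image[OF assms(2)] by (simp add: latin_squares_iff)
next
  fix j assume "j \<in> {1..n}"
  then show "bij_betw (\<lambda>i. L (\<alpha> i, j)) {1..n} {1..n}"
    using assms bij_betw_trans[OF permutes_imp_bij[OF assms(2)], of "\<lambda>i. L (i, j)" "{1..n}"]
    by (simp add: latin_squares_iff o_def)
qed

lemma row_perm_permute_rows:
  assumes "L \<in> latin_squares n" "\<alpha> permutes {1..n}" "i \<in> {1..n}"
  shows "row_perm n (permute_rows n \<alpha> L) i = row_perm n L (\<alpha> i)"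
  using assms permutes_in_image[OF assms(2)]
  by (intro row_perm_eqI row_perm_permutes) (auto simp: permute_rows_def row_perm_apply)

lemma col_perm_permute_rows:
  assumes "L \<in> latin_squares n" "\<alpha> permutes {1..n}" "j \<in> {1..n}"
  shows "col_perm n (permute_rows n \<alpha> L) j = col_perm n L j \<circ> \<alpha>"
proof (intro col_perm_eqI permutes_compose col_perm_permutes assms)
  fix i assume "i \<in> {1..n}"
  moreover from this have "\<alpha> i \<in> {1..n}"
    using permutes_in_image[OF assms(2)] by blast
  ultimately show "permute_rows n \<alpha> L (i, j) = (col_perm n L j \<circ> \<alpha>) i"
    using assms(3) by (simp add: permute_rows_def col_perm_apply)
qed

lemma permute_rows_permute_rows_inv:
  assumes "L \<in> latin_squares n" "\<alpha> permutes {1..n}"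
  shows "permute_rows n \<alpha> (permute_rows n (inv \<alpha>) L) = L"
    "permute_rows n (inv \<alpha>) (permute_rows n \<alpha> L) = L"
proof -
  have inv: "inv \<alpha> permutes {1..n}"
    by (rule permutes_inv) fact
  have in_range: "\<alpha> i \<in> {1..n}" "inv \<alpha> i \<in> {1..n}" if "i \<in> {1..n}" for i
    using that permutes_in_image[OF assms(2)] permutes_in_image[OF inv] by blast+
  show "permute_rows n \<alpha> (permute_rows n (inv \<alpha>) L) = L"
    using assms inv in_range permutes_inverses[OF assms(2)]
    by (intro latin_eqI[of _ n] permute_rows_latin) (simp_all add: permute_rows_def)
  show "permute_rows n (inv \<alpha>) (permute_rows n \<alpha> L) = L"
    using assms inv in_range permutes_inverses[OF assms(2)]
    by (intro latin_eqI[of _ n] permute_rows_latin) (simp_all add: permute_rows_def)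
qed

text \<open>The rows are only reordered, which leaves their product of signs alone, while each of
  the \<open>n\<close> columns is precomposed with \<open>\<alpha>\<close>.\<close>

lemma latin_sign_permute_rows:
  assumes "L \<in> latin_squares n" "\<alpha> permutes {1..n}"
  shows "latin_sign n (permute_rows n \<alpha> L) = sign \<alpha> ^ n * latin_sign n L"
proof -
  have "row_sign n (permute_rows n \<alpha> L) = (\<Prod>i\<in>{1..n}. sign (row_perm n L (\<alpha> i)))"
    unfolding row_sign_def using assms by (intro prod.cong refl) (simp add: row_perm_permute_rows)
  also have "\<dots> = row_sign n L"
    unfolding row_sign_def by (rule prod.reindex_bij_betw[OF permutes_imp_bij[OF assms(2)]])
  finally have 1: "row_sign n (permute_rows n \<alpha> L) = row_sign n L" .
  have "col_sign n (permute_rows n \<alpha> L) = (\<Prod>j\<in>{1..n}. sign (col_perm n L j) * sign \<alpha>)"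
    unfolding col_sign_def using assms
    by (intro prod.cong refl)
      (simp add: col_perm_permute_rows sign_comp_permutes[of "{1..n}"] col_perm_permutes)
  then have "col_sign n (permute_rows n \<alpha> L) = col_sign n L * sign \<alpha> ^ n"
    by (simp add: prod.distrib col_sign_def)
  with 1 show ?thesis by (simp add: latin_sign_eq)
qed

section \<open>The conjugate exchanging rows and symbols\<close>

text \<open>Entry \<open>(i, j)\<close> is the row of \<open>M\<close> in which column
  \<open>j\<close> has symbol \<open>i\<close>: a triple (row, column, symbol) becomes (symbol,
  column, row).\<close>

definition row_symbol_conj :: "nat \<Rightarrow> (nat \<times> nat \<Rightarrow> nat) \<Rightarrow> nat \<times> nat \<Rightarrow> nat"
  where "row_symbol_conj n M = array n (\<lambda>i j. inv (col_perm n M j) i)"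

lemma inj_on_imp_bij_betw_self: "finite A \<Longrightarrow> inj_on f A \<Longrightarrow> f ` A \<subseteq> A \<Longrightarrow> bij_betw f A A"
  by (simp add: bij_betw_def endo_inj_surj)

context
  fixes n :: nat and M :: "nat \<times> nat \<Rightarrow> nat"
  assumes M: "M \<in> latin_squares n"
begin

lemma inv_col_perm:
  assumes "i \<in> {1..n}" "j \<in> {1..n}"
  shows "inv (col_perm n M j) i \<in> {1..n}" "M (inv (col_perm n M j) i, j) = i"
proof -
  have c: "col_perm n M j permutes {1..n}"
    using M assms(2) by (rule col_perm_permutes)
  show *: "inv (col_perm n M j) i \<in> {1..n}"
    using permutes_in_image[OF permutes_inv[OF c]] assms(1) by blast
  show "M (inv (col_perm n M j) i, j) = i"
    using permutes_inverses(1)[OF c] col_perm_apply[OF *] by metis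
qed

text \<open>The columns are inverses of permutations. A repetition in row \<open>i\<close> would
  place symbol \<open>i\<close> twice in one row of \<open>M\<close>.\<close>

lemma row_symbol_conj_latin: "row_symbol_conj n M \<in> latin_squares n"
  unfolding row_symbol_conj_def
proof (intro array_latin)
  fix i assume i: "i \<in> {1..n}"
  have "inj_on (\<lambda>j. inv (col_perm n M j) i) {1..n}"
  proof (rule inj_onI)
    fix j j' assume j: "j \<in> {1..n}" "j' \<in> {1..n}"
      and eq: "inv (col_perm n M j) i = inv (col_perm n M j') i"
    let ?k = "inv (col_perm n M j) i"
    have "M (?k, j) = M (?k, j')"
      using inv_col_perm(2)[OF i j(1)] inv_col_perm(2)[OF i j(2)] eq by simp
    moreover have "inj_on (\<lambda>j. M (?k, j)) {1..n}"
      using M inv_col_perm(1)[OF i j(1)] by (simp add: latin_squares_iff bij_betw_def)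
    ultimately show "j = j'"
      using j by (meson inj_onD)
  qed
  then show "bij_betw (\<lambda>j. inv (col_perm n M j) i) {1..n} {1..n}"
    using inv_col_perm(1)[OF i] by (intro inj_on_imp_bij_betw_self) auto
next
  fix j assume "j \<in> {1..n}"
  then show "bij_betw (\<lambda>i. inv (col_perm n M j) i) {1..n} {1..n}"
    using M by (auto intro!: permutes_imp_bij permutes_inv col_perm_permutes)
qed

lemma col_perm_row_symbol_conj:
  "j \<in> {1..n} \<Longrightarrow> col_perm n (row_symbol_conj n M) j = inv (col_perm n M j)"
  using M by (intro col_perm_eqI permutes_inv col_perm_permutes) (auto simp: row_symbol_conj_def)

end

lemma row_symbol_conj_conj:
  assumes M: "M \<in> latin_squares n"
  shows "row_symbol_conj n (row_symbol_conj n M) = M"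
proof (rule latin_eqI[of _ n])
  fix i j assume ij: "i \<in> {1..n}" "j \<in> {1..n}"
  then have "row_symbol_conj n (row_symbol_conj n M) (i, j) = inv (inv (col_perm n M j)) i"
    by (simp add: row_symbol_conj_def[of n "row_symbol_conj n M"] col_perm_row_symbol_conj[OF M])
  also have "\<dots> = M (i, j)"
    using ij by (simp add: permutes_inv_inv[OF col_perm_permutes[OF M]] col_perm_apply)
  finally show "row_symbol_conj n (row_symbol_conj n M) (i, j) = M (i, j)" .
qed (intro row_symbol_conj_latin M)+

text \<open>All the signs are read off from permutations of cells satisfying
  \<open>rM \<circ> s \<circ> cN \<circ> s = s \<circ> rN\<close>. The sign of \<open>s\<close>
  occurs twice on the left and once on the right, so one copy survives.\<close>

lemma row_sign_eq_latin_sign_conj: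
  assumes M: "M \<in> latin_squares n"
  shows "row_sign n M = (-1) ^ (n * (n - 1) div 2) * latin_sign n (row_symbol_conj n M)"
proof -
  define N where "N = row_symbol_conj n M"
  define P where "P = {(i, j). i \<in> {1..n} \<and> j \<in> {1..n} \<and> i < j}"
  define s where "s = swap_on P"
  define rM where "rM = fibrewise {1..n} (row_perm n M)"
  define rN where "rN = fibrewise {1..n} (row_perm n N)"
  define cN where "cN = fibrewise {1..n} (col_perm n N)"
  have N: "N \<in> latin_squares n"
    unfolding N_def using M by (rule row_symbol_conj_latin)
  have "P \<subseteq> {1..n} \<times> {1..n}"
    by (auto simp: P_def)
  then have "finite P"
    by (rule finite_subset) simp
  then have s: "permutation s" "sign s = (-1) ^ (n * (n - 1) div 2)"
    using swap_on_permutation_sign[of P] card_less_pairs[of n] by (auto simp: s_def P_def)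
  have rM: "permutation rM" "sign rM = row_sign n M"
    and rN: "permutation rN" "sign rN = row_sign n N"
    and cN: "permutation cN" "sign cN = col_sign n N"
    unfolding rM_def rN_def cN_def row_sign_def col_sign_def
    using fibrewise_permutation_sign[of "{1..n}" "{1..n}"] row_perm_permutes[OF M]
      row_perm_permutes[OF N] col_perm_permutes[OF N] by auto
  have s_apply: "s (i, j) = (if i \<in> {1..n} \<and> j \<in> {1..n} then (j, i) else (i, j))" for i j
    by (auto simp: s_def swap_on_def P_def)
  \<comment> \<open>Both sides send \<open>(i, j)\<close> to \<open>(N (i, j), i)\<close>, because
    \<open>M\<close> has symbol \<open>i\<close> in row \<open>N (i, j)\<close> of column
    \<open>j\<close>. Cells outside the square are fixed by every factor.\<close>
  have "rM (s (cN (s (i, j)))) = s (rN (i, j))" for i j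
  proof (cases "i \<in> {1..n} \<and> j \<in> {1..n}")
    case True
    then have k: "N (i, j) \<in> {1..n}" "M (N (i, j), j) = i"
      using inv_col_perm[OF M] by (auto simp: N_def row_symbol_conj_def)
    then show ?thesis
      using True by (simp add: s_apply rM_def rN_def cN_def fibrewise_def row_perm_apply col_perm_apply)
  next
    case False
    then show ?thesis
      by (auto simp: s_apply rM_def rN_def cN_def fibrewise_def row_perm_def col_perm_def)
  qed
  \<comment> \<open>The rows of \<open>M\<close> are the symbol permutations of \<open>N\<close>, so taking signs here expresses the symbol
    sign of \<open>N\<close> by its row and column signs and the sign of the coordinate swap.\<close>
  then have "rM \<circ> (s \<circ> (cN \<circ> s)) = s \<circ> rN"
    by (auto simp: fun_eq_iff)
  then have "sign (rM \<circ> (s \<circ> (cN \<circ> s))) = sign (s \<circ> rN)"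
    by simp
  then have "sign rM * (sign s * (sign cN * sign s)) = sign s * sign rN"
    using s rM rN cN by (simp only: sign_compose permutation_compose)
  then have "sign rM * sign cN = sign s * sign rN"
    by (simp add: mult.left_commute mult.commute)
  moreover have "sign cN * sign cN = 1"
    by simp
  ultimately have "sign rM = sign s * sign rN * sign cN"
    by (metis mult.assoc mult.right_neutral)
  then show ?thesis
    using s rM rN cN by (simp add: latin_sign_eq N_def)
qed

section \<open>Signed counts of Latin squares\<close>

text \<open>A sign squares to \<open>1\<close>, so it is the difference of the indicators of even
  and odd.\<close>

lemma signed_count_eq_sum_latin_sign:
  assumes "finite S"
  shows "int (card {L \<in> S. latin_even n L}) - int (card {L \<in> S. latin_odd n L})
    = (\<Sum>L\<in>S. latin_sign n L)"
proof -
  have sq: "(\<Prod>i\<in>{1..n}. sign (p i)) * (\<Prod>i\<in>{1..n}. sign (p i)) = 1" for p :: "nat \<Rightarrow> nat \<Rightarrow> nat"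
    by (simp flip: prod.distrib)
  have "x * y * (x * y) = 1" if "x * x = 1" "y * y = 1" for x y :: int
    using that by (metis mult.assoc mult.commute mult_1)
  then have "latin_sign n L * latin_sign n L = 1" for L
    unfolding latin_sign_def using sq by blast
  then have "latin_sign n L = 1 \<or> latin_sign n L = -1" for L
    by (metis zmult_eq_1_iff)
  then have "latin_sign n L = of_bool (latin_even n L) - of_bool (latin_odd n L)" for L
    unfolding latin_even_def latin_odd_def
    by (cases "latin_sign n L = 1") (force+)
  then have "(\<Sum>L\<in>S. latin_sign n L)
      = (\<Sum>L\<in>S. of_bool (latin_even n L)) - (\<Sum>L\<in>S. of_bool (latin_odd n L))"
    by (simp add: sum_subtractf)
  then show ?thesis
    using assms by (simp add: Int_def)
qed

lemma AT_eq_sum: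
  "AT n = (\<Sum>L | L \<in> latin_squares n \<and> normalized n L \<and> unipotent n L. latin_sign n L)"
  using signed_count_eq_sum_latin_sign[of "{L \<in> latin_squares n. normalized n L \<and> unipotent n L}" n]
  by (simp add: AT_def U_even_def U_odd_def conj_assoc)

lemma reduced_count_eq_sum:
  "int (R_even n) - int (R_odd n)
    = (\<Sum>L | L \<in> latin_squares n \<and> reduced n L. latin_sign n L)"
  using signed_count_eq_sum_latin_sign[of "{L \<in> latin_squares n. reduced n L}" n]
  by (simp add: R_even_def R_odd_def conj_assoc)

section \<open>Sums over Latin squares grouped by their first row or column\<close>

lemma card_permutes_fixing:
  assumes "finite S" "a \<in> S"
  shows "card {p. p permutes S \<and> p a = a} = fact (card S - 1)"
proof -
  have "{p. p permutes S \<and> p a = a} = {p. p permutes (S - {a})}"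
  proof safe
    fix p assume p: "p permutes S" "p a = a"
    show "p permutes (S - {a})"
      by (rule permutes_superset[OF p(1)]) (use p(2) in blast)
  next
    fix p assume p: "p permutes (S - {a})"
    show "p permutes S"
      by (rule permutes_subset[OF p]) blast
    show "p a = a"
      by (rule permutes_not_in[OF p]) simp
  qed
  then show ?thesis
    using card_permutations[of "S - {a}" "card S - 1"] assms by simp
qed

lemma sum_first_row_eq:
  assumes \<pi>: "\<pi> permutes {1..n}" and n: "n \<ge> 1"
  shows "(\<Sum>L | L \<in> latin_squares n \<and> row_perm n L 1 = \<pi>. h L)
    = (\<Sum>L | L \<in> latin_squares n \<and> normalized n L. h (relabel n \<pi> L))"
proof (rule sum.reindex_bij_witness[of _ "relabel n \<pi>" "relabel n (inv \<pi>)"])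
  have one: "1 \<in> {1..n}"
    using n by (simp add: atLeastAtMost_iff)
  have inv: "inv \<pi> permutes {1..n}"
    using \<pi> by (rule permutes_inv)
  fix L
  show "L \<in> {L. L \<in> latin_squares n \<and> row_perm n L 1 = \<pi>} \<Longrightarrow>
      relabel n (inv \<pi>) L \<in> {L. L \<in> latin_squares n \<and> normalized n L}"
    using one inv permutes_inv_o[OF \<pi>]
    by (auto simp: normalized_def row_perm_relabel intro: relabel_latin)
  show "L \<in> {L. L \<in> latin_squares n \<and> normalized n L} \<Longrightarrow>
      relabel n \<pi> L \<in> {L. L \<in> latin_squares n \<and> row_perm n L 1 = \<pi>}"
    using one \<pi> by (auto simp: normalized_def row_perm_relabel intro: relabel_latin)
qed (use \<pi> in \<open>auto simp: relabel_relabel_inv\<close>)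

text \<open>Relabelling multiplies the row sign by \<open>sign \<pi> ^ n\<close>, which is
  \<open>sign \<pi>\<close> for odd \<open>n\<close>.\<close>

lemma sum_row_sign_first_row:
  assumes "odd n" "\<pi> permutes {1..n}"
  shows "(\<Sum>M | M \<in> latin_squares n \<and> row_perm n M 1 = \<pi>. row_sign n M)
    = sign \<pi> * (\<Sum>M | M \<in> latin_squares n \<and> normalized n M. row_sign n M)"
  using assms odd_pos[of n]
  by (simp add: sum_first_row_eq row_sign_relabel sign_power_odd sum_distrib_left)

text \<open>The first row \<open>\<alpha>\<close> of such a square fixes \<open>1\<close>.
  Relabelling by \<open>inv \<alpha>\<close> keeps the diagonal and the sign and normalizes the
  square, so each of the \<open>(n - 1)!\<close> classes contributes \<open>AT n\<close>.\<close>

lemma sum_latin_sign_diag_one: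
  assumes n: "n \<ge> 1"
  shows "(\<Sum>N | N \<in> latin_squares n \<and> (\<forall>i\<in>{1..n}. N (i, i) = 1). latin_sign n N) = fact (n - 1) * AT n"
proof -
  let ?D = "{N. N \<in> latin_squares n \<and> (\<forall>i\<in>{1..n}. N (i, i) = 1)}"
  let ?T = "{\<alpha>. \<alpha> permutes {1..n} \<and> \<alpha> 1 = 1}"
  have one: "1 \<in> {1..n}"
    using n by (simp add: atLeastAtMost_iff)
  have "(\<Sum>N\<in>?D. latin_sign n N) = (\<Sum>\<alpha>\<in>?T. \<Sum>N | N \<in> ?D \<and> row_perm n N 1 = \<alpha>. latin_sign n N)"
    by (rule sum.group[symmetric])
      (use one in \<open>auto intro!: finite_subset[OF _ finite_permutations[of "{1..n}"]] row_perm_permutes simp: row_perm_apply\<close>)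
  also have "\<dots> = (\<Sum>\<alpha>\<in>?T. AT n)"
  proof (rule sum.cong[OF refl])
    fix \<alpha> assume "\<alpha> \<in> ?T"
    then have \<alpha>: "\<alpha> permutes {1..n}" "\<alpha> 1 = 1"
      by auto
    have inv: "inv \<alpha> permutes {1..n}" "inv \<alpha> 1 = 1"
      using \<alpha> permutes_inv[OF \<alpha>(1)] permutes_inv_eq[OF \<alpha>(1)] by auto
    show "(\<Sum>N | N \<in> ?D \<and> row_perm n N 1 = \<alpha>. latin_sign n N) = AT n"
      unfolding AT_eq_sum
    proof (rule sum.reindex_bij_witness[of _ "relabel n \<alpha>" "relabel n (inv \<alpha>)"])
      fix N
      show "N \<in> {N. N \<in> ?D \<and> row_perm n N 1 = \<alpha>} \<Longrightarrow>
          relabel n (inv \<alpha>) N \<in> {L. L \<in> latin_squares n \<and> normalized n L \<and> unipotent n L}"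
        using one inv permutes_inv_o[OF \<alpha>(1)]
        by (simp add: normalized_def unipotent_def row_perm_relabel relabel_latin) (simp add: relabel_def)
      show "N \<in> {L. L \<in> latin_squares n \<and> normalized n L \<and> unipotent n L} \<Longrightarrow>
          relabel n \<alpha> N \<in> {N. N \<in> ?D \<and> row_perm n N 1 = \<alpha>}"
      proof -
        assume "N \<in> {L. L \<in> latin_squares n \<and> normalized n L \<and> unipotent n L}"
        then have N: "N \<in> latin_squares n" "row_perm n N 1 = id" and u: "unipotent n N"
          by (auto simp: normalized_def)
        \<comment> \<open>Normalization fixes the corner entry, so the constant on the diagonal can
          only be \<open>1\<close>.\<close>
        have "N (1, 1) = 1"
          using N(2) row_perm_apply[OF one, of N 1] by simp
        then have "N (i, i) = 1" if "i \<in> {1..n}" for i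
          using u one that unfolding unipotent_def by metis
        then show ?thesis
          using N \<alpha> one by (simp add: row_perm_relabel relabel_latin) (simp add: relabel_def)
      qed
    qed (use \<alpha> inv in \<open>auto simp: relabel_relabel_inv latin_sign_relabel\<close>)
  qed
  also have "\<dots> = fact (n - 1) * AT n"
    using card_permutes_fixing[of "{1..n}" 1] one by simp
  finally show ?thesis .
qed

lemma sum_row_sign_normalized:
  assumes n: "n \<ge> 1"
  shows "(\<Sum>M | M \<in> latin_squares n \<and> normalized n M. row_sign n M)
    = (-1) ^ (n * (n - 1) div 2) * fact (n - 1) * AT n"
proof -
  have one: "1 \<in> {1..n}"
    using n by (simp add: atLeastAtMost_iff)
  \<comment> \<open>Both sides say that column \<open>j\<close> of \<open>M\<close> has symbol
    \<open>j\<close> in row \<open>1\<close>. Hence a normalized first row corresponds to a diagonal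
    of ones.\<close>
  have diag: "row_symbol_conj n M (j, j) = 1 \<longleftrightarrow> M (1, j) = j"
    if "M \<in> latin_squares n" "j \<in> {1..n}" for M j
    using that permutes_inv_eq[OF col_perm_permutes[OF that], of j 1] one
    by (simp add: row_symbol_conj_def col_perm_apply)
  have norm: "normalized n M \<longleftrightarrow> (\<forall>j\<in>{1..n}. M (1, j) = j)" for M
    unfolding normalized_def row_perm_def by (auto simp: fun_eq_iff restrict_id_def)
  let ?D = "{N. N \<in> latin_squares n \<and> (\<forall>i\<in>{1..n}. N (i, i) = 1)}"
  have "(\<Sum>M | M \<in> latin_squares n \<and> normalized n M. row_sign n M)
      = (\<Sum>N\<in>?D. (-1) ^ (n * (n - 1) div 2) * latin_sign n N)"
  proof (rule sum.reindex_bij_witness[of _ "row_symbol_conj n" "row_symbol_conj n"])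
    fix N
    assume "N \<in> ?D"
    then show "row_symbol_conj n N \<in> {M. M \<in> latin_squares n \<and> normalized n M}"
      using diag[OF row_symbol_conj_latin, of N]
      by (auto simp: norm row_symbol_conj_conj row_symbol_conj_latin)
  qed (auto simp: norm diag row_symbol_conj_conj row_symbol_conj_latin row_sign_eq_latin_sign_conj)
  also have "\<dots> = (-1) ^ (n * (n - 1) div 2) * (fact (n - 1) * AT n)"
    using sum_latin_sign_diag_one[OF n] by (simp add: sum_distrib_left[symmetric])
  finally show ?thesis by (simp add: mult.assoc)
qed

text \<open>Permuting rows by the inverse of the first column \<open>\<alpha>\<close> reduces the
  square. As \<open>n\<close> is odd, this changes \<open>latin_sign\<close> by
  \<open>sign \<alpha>\<close>, exactly the weight in the sum.\<close>

lemma sum_normalized_sign_first_col: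
  assumes "odd n"
  shows "(\<Sum>L | L \<in> latin_squares n \<and> normalized n L. sign (col_perm n L 1) * latin_sign n L)
    = fact (n - 1) * (int (R_even n) - int (R_odd n))"
proof -
  let ?D = "{L. L \<in> latin_squares n \<and> normalized n L}"
  let ?T = "{\<alpha>. \<alpha> permutes {1..n} \<and> \<alpha> 1 = 1}"
  let ?h = "\<lambda>L. sign (col_perm n L 1) * latin_sign n L"
  have one: "1 \<in> {1..n}"
    using odd_pos[OF assms] by (simp add: atLeastAtMost_iff)
  \<comment> \<open>With \<open>1\<close> in the corner, the first column ranges over permutations
    fixing \<open>1\<close>, whence \<open>(n - 1)!\<close> classes.\<close>
  have "L (1, 1) = 1" if "row_perm n L 1 = id" for L
    using row_perm_apply[OF one, of L 1] that by simp
  then have "(\<Sum>L\<in>?D. ?h L) = (\<Sum>\<alpha>\<in>?T. \<Sum>L | L \<in> ?D \<and> col_perm n L 1 = \<alpha>. ?h L)"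
    by (intro sum.group[symmetric])
      (use one in \<open>auto intro!: finite_subset[OF _ finite_permutations[of "{1..n}"]] col_perm_permutes
        simp: col_perm_apply normalized_def\<close>)
  also have "\<dots> = (\<Sum>\<alpha>\<in>?T. int (R_even n) - int (R_odd n))"
  proof (rule sum.cong[OF refl])
    fix \<alpha> assume "\<alpha> \<in> ?T"
    then have \<alpha>: "\<alpha> permutes {1..n}" "\<alpha> 1 = 1"
      by auto
    have inv: "inv \<alpha> permutes {1..n}" "inv \<alpha> 1 = 1"
      using \<alpha> permutes_inv[OF \<alpha>(1)] permutes_inv_eq[OF \<alpha>(1)] by auto
    show "(\<Sum>L | L \<in> ?D \<and> col_perm n L 1 = \<alpha>. ?h L) = int (R_even n) - int (R_odd n)"
      unfolding reduced_count_eq_sum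
    proof (rule sum.reindex_bij_witness[of _ "permute_rows n \<alpha>" "permute_rows n (inv \<alpha>)"])
      fix L
      show "L \<in> {L. L \<in> ?D \<and> col_perm n L 1 = \<alpha>} \<Longrightarrow>
          permute_rows n (inv \<alpha>) L \<in> {L. L \<in> latin_squares n \<and> reduced n L}"
        using one inv permutes_inv_o[OF \<alpha>(1)]
        by (auto simp: normalized_def reduced_def row_perm_permute_rows col_perm_permute_rows
            permute_rows_latin)
      show "L \<in> {L. L \<in> latin_squares n \<and> reduced n L} \<Longrightarrow>
          permute_rows n \<alpha> L \<in> {L. L \<in> ?D \<and> col_perm n L 1 = \<alpha>}"
        using one \<alpha> by (auto simp: normalized_def reduced_def row_perm_permute_rows
            col_perm_permute_rows permute_rows_latin)
      show "L \<in> {L. L \<in> ?D \<and> col_perm n L 1 = \<alpha>} \<Longrightarrow>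
          latin_sign n (permute_rows n (inv \<alpha>) L) = ?h L"
        using \<alpha> inv assms
        by (auto simp: latin_sign_permute_rows sign_power_odd sign_inv_permutes[of "{1..n}"])
    qed (use \<alpha> in \<open>auto simp: permute_rows_permute_rows_inv\<close>)
  qed
  also have "\<dots> = fact (n - 1) * (int (R_even n) - int (R_odd n))"
    using card_permutes_fixing[of "{1..n}" 1] one by simp
  finally show ?thesis .
qed

text \<open>Relabelling by \<open>\<pi>\<close> multiplies the signs of the first row and of the
  first column by \<open>sign \<pi>\<close> each. These cancel, so all \<open>n!\<close> possible
  first rows contribute equally.\<close>

lemma sum_sign_first_row_col:
  assumes "odd n"
  shows "(\<Sum>L\<in>latin_squares n. sign (row_perm n L 1) * sign (col_perm n L 1) * latin_sign n L)
    = fact n * fact (n - 1) * (int (R_even n) - int (R_odd n))"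
proof -
  let ?h = "\<lambda>L. sign (row_perm n L 1) * sign (col_perm n L 1) * latin_sign n L"
  have n: "n \<ge> 1"
    using odd_pos[OF assms] by simp
  then have one: "1 \<in> {1..n}"
    by (simp add: atLeastAtMost_iff)
  have "(\<Sum>L\<in>latin_squares n. ?h L)
      = (\<Sum>\<pi> | \<pi> permutes {1..n}. \<Sum>L | L \<in> latin_squares n \<and> row_perm n L 1 = \<pi>. ?h L)"
    using one by (intro sum.group[symmetric]) (auto intro!: finite_permutations row_perm_permutes)
  also have "\<dots> = (\<Sum>\<pi> | \<pi> permutes {1..n}. fact (n - 1) * (int (R_even n) - int (R_odd n)))"
  proof (rule sum.cong[OF refl])
    fix \<pi> assume "\<pi> \<in> {\<pi>. \<pi> permutes {1..n}}"
    then have \<pi>: "\<pi> permutes {1..n}" by simp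
    have "?h (relabel n \<pi> L) = sign (col_perm n L 1) * latin_sign n L"
      if "L \<in> latin_squares n" "normalized n L" for L
      using that \<pi> one
      by (simp add: row_perm_relabel col_perm_relabel latin_sign_relabel normalized_def
          sign_comp_permutes[of "{1..n}"] col_perm_permutes)
    then show "(\<Sum>L | L \<in> latin_squares n \<and> row_perm n L 1 = \<pi>. ?h L)
        = fact (n - 1) * (int (R_even n) - int (R_odd n))"
      unfolding sum_first_row_eq[OF \<pi> n] sum_normalized_sign_first_col[OF assms, symmetric]
      by (intro sum.cong) auto
  qed
  also have "\<dots> = fact n * fact (n - 1) * (int (R_even n) - int (R_odd n))"
    using card_permutations[of "{1..n}" n] by simp
  finally show ?thesis .
qed

section \<open>The coefficient of the all-ones monomial\<close>

lemma mcoeff_Const_mult: "mcoeff (Const c * p) m = c * mcoeff p m" for c :: "'a::comm_ring_1"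
  unfolding mcoeff_def Const_def mult_map_scale_conv_mult[symmetric]
  by (simp add: Poly_Mapping.map.rep_eq when_def)

lemma of_int_eq_Const: "of_int k = Const (of_int k)"
  unfolding Const_def by simp

lemma prod_Var:
  "finite A \<Longrightarrow> (\<Prod>a\<in>A. Var (g a) :: ('v, 'a::comm_semiring_1) mpoly)
    = Poly_Mapping.single (\<Sum>a\<in>A. Poly_Mapping.single (g a) 1) 1"
  by (induction A rule: finite_induct) (simp_all add: Var_def mult_single)

text \<open>The exponent of \<open>y\<close> on the left counts the preimages of \<open>y\<close>.
  If all exponents on \<open>A\<close> are \<open>1\<close>, then \<open>g\<close> maps the finite
  set \<open>A\<close> onto itself.\<close>

lemma sum_single_eq_iff_bij_betw:
  assumes "finite A" "g ` A \<subseteq> A"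
  shows "(\<Sum>a\<in>A. Poly_Mapping.single (g a) (1::nat)) = (\<Sum>a\<in>A. Poly_Mapping.single a 1)
    \<longleftrightarrow> bij_betw g A A"
proof
  assume eq: "(\<Sum>a\<in>A. Poly_Mapping.single (g a) (1::nat)) = (\<Sum>a\<in>A. Poly_Mapping.single a 1)"
  have "y \<in> g ` A" if "y \<in> A" for y
  proof (rule ccontr)
    assume "y \<notin> g ` A"
    then have "(\<Sum>a\<in>A. Poly_Mapping.lookup (Poly_Mapping.single (g a) (1::nat)) y) = 0"
      by (intro sum.neutral) (auto simp: lookup_single when_def)
    moreover have "(\<Sum>a\<in>A. Poly_Mapping.lookup (Poly_Mapping.single a (1::nat)) y) = 1"
      using assms(1) that by (simp add: lookup_single when_def)
    ultimately show False
      using arg_cong[OF eq, of "\<lambda>p. Poly_Mapping.lookup p y"] by (simp add: lookup_sum)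
  qed
  then have "g ` A = A"
    using assms(2) by blast
  then show "bij_betw g A A"
    using assms(1) by (simp add: bij_betw_def eq_card_imp_inj_on)
qed (rule sum.reindex_bij_betw)

text \<open>Trades coefficient extraction for an integer sum: a product of variables is the all-ones
  monomial exactly when its index map permutes the cells.\<close>

lemma mcoeff_sum_prod_Var:
  fixes c :: rat
  assumes "\<And>x i j. x \<in> S \<Longrightarrow> i \<in> {1..n} \<Longrightarrow> j \<in> {1..n} \<Longrightarrow> f x i j \<in> {1..n} \<times> {1..n}"
  shows "mcoeff (Const c * (\<Sum>x\<in>S. of_int (k x) * (\<Prod>i\<in>{1..n}. \<Prod>j\<in>{1..n}. Var (f x i j))))
      (all_ones_monomial n)
    = c * of_int (\<Sum>x\<in>S. k x *
        of_bool (bij_betw (\<lambda>(i, j). f x i j) ({1..n} \<times> {1..n}) ({1..n} \<times> {1..n})))"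
proof -
  let ?A = "{1..n} \<times> {1..n}"
  have ones: "all_ones_monomial n = (\<Sum>a\<in>?A. Poly_Mapping.single a 1)"
    by (simp add: all_ones_monomial_def sum.cartesian_product)
  have "mcoeff (of_int (k x) * (\<Prod>i\<in>{1..n}. \<Prod>j\<in>{1..n}. Var (f x i j))) (all_ones_monomial n)
      = (of_int (k x * of_bool (bij_betw (\<lambda>(i, j). f x i j) ?A ?A)) :: rat)" if "x \<in> S" for x
  proof -
    let ?g = "\<lambda>(i, j). f x i j"
    have "(\<Prod>i\<in>{1..n}. \<Prod>j\<in>{1..n}. Var (f x i j) :: (nat \<times> nat, rat) mpoly)
        = Poly_Mapping.single (\<Sum>a\<in>?A. Poly_Mapping.single (?g a) 1) 1"
      using prod_Var[of ?A ?g] by (simp add: prod.cartesian_product case_prod_unfold)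
    moreover have "?g ` ?A \<subseteq> ?A"
      using assms[OF that]
      by (intro image_subsetI) (auto simp only: case_prod_unfold mem_Times_iff)
    ultimately show ?thesis
      unfolding of_int_eq_Const[of "k x"] mcoeff_Const_mult
      using sum_single_eq_iff_bij_betw[of ?A ?g]
      by (simp add: mcoeff_def lookup_single when_def ones)
  qed
  then show ?thesis
    unfolding mcoeff_Const_mult by (simp add: mcoeff_def lookup_sum)
qed

section \<open>Evaluation of the signed sum\<close>

lemma Sym_tuples_permutes: "\<sigma> \<in> Sym_tuples n \<Longrightarrow> i \<in> {1..n} \<Longrightarrow> \<sigma> i permutes {1..n}"
  by (auto simp: Sym_tuples_def Sym_def)

lemma finite_Sym_tuples [simp]: "finite (Sym_tuples n)"
  unfolding Sym_tuples_def Sym_def by (intro finite_PiE) (auto intro: finite_permutations)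

text \<open>
  Counting the occurrences of a fixed symbol: each row has one, each column but the first has one,
  so the first column has exactly one.
\<close>

lemma inj_on_first_col:
  fixes n :: nat
  assumes rows: "\<And>i. i \<in> {1..n} \<Longrightarrow> \<sigma> i permutes {1..n}"
    and cols: "\<And>j. j \<in> {1..n} \<Longrightarrow> j \<noteq> 1 \<Longrightarrow> bij_betw (\<lambda>i. \<sigma> i j) {1..n} {1..n}"
  shows "inj_on (\<lambda>i. \<sigma> i 1) {1..n}"
proof (rule inj_onI, rule ccontr)
  fix a b assume ab: "a \<in> {1..n}" "b \<in> {1..n}" "\<sigma> a 1 = \<sigma> b 1" "a \<noteq> b"
  define k where "k = \<sigma> a 1"
  have one: "1 \<in> {1..n}"
    using ab(1) by (auto simp: atLeastAtMost_iff)
  have k: "k \<in> {1..n}"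
    using permutes_in_image[OF rows[OF ab(1)]] one by (simp add: k_def)
  \<comment> \<open>Here \<open>inv (\<sigma> i) k\<close> is the column where row \<open>i\<close>
    has \<open>k\<close>. Rows \<open>a\<close> and \<open>b\<close> have it in column
    \<open>1\<close>, so the other \<open>n - 2\<close> rows would have to serve
    \<open>n - 1\<close> columns.\<close>
  have "{1..n} - {1} \<subseteq> (\<lambda>i. inv (\<sigma> i) k) ` ({1..n} - {a, b})"
  proof
    fix j assume j: "j \<in> {1..n} - {1}"
    then have "k \<in> (\<lambda>i. \<sigma> i j) ` {1..n}"
      using cols[of j] k by (simp add: bij_betw_def)
    then obtain i where i: "k = \<sigma> i j" "i \<in> {1..n}"
      by (rule imageE)
    have "\<sigma> i 1 \<noteq> k"
      using permutes_inj[OF rows[OF i(2)]] i(1) j by (auto dest: injD)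
    then have "i \<notin> {a, b}"
      using ab(3) by (auto simp: k_def)
    moreover have "inv (\<sigma> i) k = j"
      using permutes_inverses(2)[OF rows[OF i(2)]] i(1) by simp
    ultimately show "j \<in> (\<lambda>i. inv (\<sigma> i) k) ` ({1..n} - {a, b})"
      using i(2) by blast
  qed
  then have "card ({1..n} - {1}) \<le> card ({1..n} - {a, b})"
    by (rule surj_card_le[rotated]) simp
  moreover have "card ({1..n} - {a, b}) = n - 2" "card ({1..n} - {1}) = n - 1"
    using ab one by (auto simp: card_Diff_subset)
  \<comment> \<open>Yields \<open>n \<ge> 2\<close>; otherwise truncated subtraction could make
    \<open>n - 2\<close> and \<open>n - 1\<close> equal.\<close>
  moreover have "card {a, b} \<le> card {1..n}"
    using ab by (intro card_mono) auto
  ultimately show False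
    using ab(4) by simp
qed

text \<open>An orthogonality condition: superposing \<open>L\<close> with the array whose column
  \<open>j\<close> is \<open>\<rho> j\<close> shows every ordered pair exactly once.\<close>

definition cell_bij :: "nat \<Rightarrow> (nat \<times> nat \<Rightarrow> nat) \<Rightarrow> (nat \<Rightarrow> nat \<Rightarrow> nat) \<Rightarrow> bool"
  where "cell_bij n L \<rho> \<longleftrightarrow>
    bij_betw (\<lambda>(i, j). (L (i, j), \<rho> j i)) ({1..n} \<times> {1..n}) ({1..n} \<times> {1..n})"

text \<open>The repeated entry allows a swap inside \<open>\<rho> j\<close> that leaves the set of
  superposed pairs unchanged. Since \<open>j \<noteq> 1\<close>, the constraint
  \<open>\<rho> 1 = id\<close> survives.\<close>

lemma sum_tuple_sign_eq_0:
  assumes j: "j \<in> {1..n}" "j \<noteq> 1" and ab: "a \<in> {1..n}" "b \<in> {1..n}" "a \<noteq> b"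
    and eq: "L (a, j) = L (b, j)"
  shows "(\<Sum>\<rho> | \<rho> \<in> Sym_tuples n \<and> \<rho> 1 = id \<and> cell_bij n L \<rho>. tuple_sign n \<rho>) = 0"
proof -
  let ?T = "{\<rho>. \<rho> \<in> Sym_tuples n \<and> \<rho> 1 = id \<and> cell_bij n L \<rho>}"
  define \<tau> where "\<tau> = transpose a b"
  have \<tau>: "\<tau> permutes {1..n}" "sign \<tau> = -1"
    using ab by (simp_all add: \<tau>_def permutes_swap_id sign_swap_id)
  have \<tau>\<tau>: "\<tau> (\<tau> i) = i" for i
    by (simp add: \<tau>_def)
  have \<tau>_in: "\<tau> i \<in> {1..n} \<longleftrightarrow> i \<in> {1..n}" for i
    using permutes_in_image[OF \<tau>(1)] .
  have L\<tau>: "L (\<tau> i, j) = L (i, j)" for i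
    using eq by (auto simp: \<tau>_def transpose_def)
  \<comment> \<open>A sign-reversing involution: exchange the entries of \<open>\<rho> j\<close> in the two cells with equal \<open>L\<close>.\<close>
  define \<phi> where "\<phi> \<rho> = \<rho>(j := \<rho> j \<circ> \<tau>)" for \<rho> :: "nat \<Rightarrow> nat \<Rightarrow> nat"
  have \<phi>\<phi>: "\<phi> (\<phi> \<rho>) = \<rho>" for \<rho>
    by (auto simp: \<phi>_def fun_eq_iff \<tau>\<tau>)
  have \<phi>_in: "\<phi> \<rho> \<in> ?T" if "\<rho> \<in> ?T" for \<rho>
  proof -
    let ?t = "\<lambda>(i, l). if l = j then (\<tau> i, l) else (i, l)"
    let ?A = "{1..n} \<times> {1..n}"
    from that have \<rho>: "\<rho> \<in> Sym_tuples n" "\<rho> 1 = id" "cell_bij n L \<rho>"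
      by auto
    have "\<phi> \<rho> \<in> Sym_tuples n"
      using \<rho>(1) j(1) permutes_compose[OF \<tau>(1) Sym_tuples_permutes[OF \<rho>(1) j(1)]]
      by (auto simp: Sym_tuples_def Sym_def \<phi>_def PiE_iff extensional_def)
    moreover have "\<phi> \<rho> 1 = id"
      using \<rho>(2) j(2) by (simp add: \<phi>_def)
    \<comment> \<open>The map \<open>?t\<close> exchanges the cells \<open>(a, j)\<close> and
      \<open>(b, j)\<close>. Passing to \<open>\<phi> \<rho>\<close> precomposes the superposition
      with it, as \<open>L\<close> agrees on the two cells.\<close>
    moreover have "bij_betw ?t ?A ?A"
      by (rule bij_betwI[of _ _ _ ?t]) (auto simp: \<tau>\<tau> \<tau>_in)
    then have "bij_betw ((\<lambda>(i, l). (L (i, l), \<rho> l i)) \<circ> ?t) ?A ?A"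
      using \<rho>(3) unfolding cell_bij_def by (rule bij_betw_trans)
    then have "cell_bij n L (\<phi> \<rho>)"
      unfolding cell_bij_def
      by (rule bij_betw_cong[THEN iffD1, rotated]) (auto simp: \<phi>_def L\<tau>)
    ultimately show ?thesis by simp
  qed
  have sgn: "tuple_sign n (\<phi> \<rho>) = - tuple_sign n \<rho>" if "\<rho> \<in> ?T" for \<rho>
  proof -
    have "sign (\<rho> j \<circ> \<tau>) = - sign (\<rho> j)"
      using that j \<tau> sign_comp_permutes[of "{1..n}" "\<rho> j" \<tau>] Sym_tuples_permutes by auto
    moreover have "(\<Prod>i\<in>{1..n} - {j}. sign (\<phi> \<rho> i)) = (\<Prod>i\<in>{1..n} - {j}. sign (\<rho> i))"
      by (intro prod.cong) (auto simp: \<phi>_def)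
    ultimately show ?thesis
      unfolding tuple_sign_def using j(1) by (simp add: prod.remove[of _ j] \<phi>_def)
  qed
  have "(\<Sum>\<rho>\<in>?T. tuple_sign n \<rho>) = (\<Sum>\<rho>\<in>?T. - tuple_sign n \<rho>)"
    by (rule sum.reindex_bij_witness[of _ \<phi> \<phi>]) (use \<phi>_in sgn in \<open>auto simp: \<phi>\<phi>\<close>)
  then show ?thesis
    by (simp add: sum_negf)
qed

text \<open>Let \<open>M (j, m)\<close> be the value of \<open>\<rho> j\<close> at the cell of
  column \<open>j\<close> where \<open>L\<close> has \<open>m\<close>. Then \<open>cell_bij\<close>
  says that the columns of \<open>M\<close> are bijective, and row \<open>j\<close> of
  \<open>M\<close> has sign \<open>sign (\<rho> j)\<close> times that of column \<open>j\<close> of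
  \<open>L\<close>.\<close>

lemma sum_tuple_sign_latin:
  assumes L: "L \<in> latin_squares n" and n: "n \<ge> 1"
  shows "(\<Sum>\<rho> | \<rho> \<in> Sym_tuples n \<and> \<rho> 1 = id \<and> cell_bij n L \<rho>. tuple_sign n \<rho>)
    = (\<Sum>M | M \<in> latin_squares n \<and> row_perm n M 1 = inv (col_perm n L 1).
        col_sign n L * row_sign n M)"
proof -
  have one: "1 \<in> {1..n}"
    using n by (simp add: atLeastAtMost_iff)
  let ?A = "{1..n} \<times> {1..n}"
  let ?c = "col_perm n L"
  let ?T = "{\<rho>. \<rho> \<in> Sym_tuples n \<and> \<rho> 1 = id \<and> cell_bij n L \<rho>}"
  let ?S = "{M. M \<in> latin_squares n \<and> row_perm n M 1 = inv (?c 1)}"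
  define F where "F \<rho> = array n (\<lambda>j m. \<rho> j (inv (?c j) m))" for \<rho> :: "nat \<Rightarrow> nat \<Rightarrow> nat"
  define G where "G M = (\<lambda>j\<in>{1..n}. row_perm n M j \<circ> ?c j)" for M
  have c: "?c j permutes {1..n}" if "j \<in> {1..n}" for j
    using L that by (rule col_perm_permutes)
  have F_row: "row_perm n (F \<rho>) j = \<rho> j \<circ> inv (?c j)" if "\<rho> \<in> Sym_tuples n" "j \<in> {1..n}" for \<rho> j
    using that
    by (intro row_perm_eqI permutes_compose permutes_inv c Sym_tuples_permutes) (auto simp: F_def)
  have F_in: "F \<rho> \<in> ?S" if "\<rho> \<in> ?T" for \<rho>
  proof -
    from that have \<rho>: "\<rho> \<in> Sym_tuples n" "\<rho> 1 = id" "cell_bij n L \<rho>"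
      by auto
    have "F \<rho> \<in> latin_squares n"
      unfolding F_def
    proof (rule array_latin)
      fix j assume j: "j \<in> {1..n}"
      have "\<rho> j \<circ> inv (?c j) permutes {1..n}"
        using \<rho>(1) j by (intro permutes_compose permutes_inv c Sym_tuples_permutes)
      then show "bij_betw (\<lambda>m. \<rho> j (inv (?c j) m)) {1..n} {1..n}"
        by (auto dest: permutes_imp_bij simp: o_def)
    next
      fix m assume m: "m \<in> {1..n}"
      note inv_c = inv_col_perm[OF L m]
      \<comment> \<open>Column \<open>m\<close> of \<open>F \<rho>\<close> lists the
        \<open>\<rho>\<close>-values over the cells where \<open>L\<close> has \<open>m\<close>; a
        repetition would repeat a superposed pair.\<close>
      have "inj_on (\<lambda>j. \<rho> j (inv (?c j) m)) {1..n}"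
      proof (rule inj_onI)
        fix j j' assume j: "j \<in> {1..n}" "j' \<in> {1..n}"
          and eq: "\<rho> j (inv (?c j) m) = \<rho> j' (inv (?c j') m)"
        have "inj_on (\<lambda>(i, j). (L (i, j), \<rho> j i)) ?A"
          using \<rho>(3) by (simp add: cell_bij_def bij_betw_def)
        moreover have "(\<lambda>(i, j). (L (i, j), \<rho> j i)) (inv (?c j) m, j)
            = (\<lambda>(i, j). (L (i, j), \<rho> j i)) (inv (?c j') m, j')"
          using inv_c(2)[OF j(1)] inv_c(2)[OF j(2)] eq by simp
        moreover have "(inv (?c j) m, j) \<in> ?A" "(inv (?c j') m, j') \<in> ?A"
          using inv_c(1)[OF j(1)] inv_c(1)[OF j(2)] j by auto
        ultimately have "(inv (?c j) m, j) = (inv (?c j') m, j')"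
          by (rule inj_onD)
        then show "j = j'" by simp
      qed
      moreover have "\<rho> j (inv (?c j) m) \<in> {1..n}" if "j \<in> {1..n}" for j
        using permutes_in_image[OF Sym_tuples_permutes[OF \<rho>(1) that]] inv_c(1)[OF that] by blast
      ultimately show "bij_betw (\<lambda>j. \<rho> j (inv (?c j) m)) {1..n} {1..n}"
        by (intro inj_on_imp_bij_betw_self) auto
    qed
    then show ?thesis
      using F_row[OF \<rho>(1) one] \<rho>(2) by simp
  qed
  have G_apply: "G M j i = M (j, L (i, j))"
    if "i \<in> {1..n}" "j \<in> {1..n}" for M i j
    using that latin_in_range[OF L that] by (simp add: G_def col_perm_apply row_perm_apply)
  have G_in: "G M \<in> ?T" if "M \<in> ?S" for M
  proof -
    from that have M: "M \<in> latin_squares n" "row_perm n M 1 = inv (?c 1)"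
      by auto
    have "G M \<in> Sym_tuples n"
      by (auto simp: Sym_tuples_def Sym_def G_def intro!: permutes_compose c row_perm_permutes M(1))
    moreover have "G M 1 = id"
      using one M(2) permutes_inv_o(2)[OF c[OF one]] by (simp add: G_def)
    moreover have "cell_bij n L (G M)"
      unfolding cell_bij_def
    proof (rule inj_on_imp_bij_betw_self)
      show "inj_on (\<lambda>(i, j). (L (i, j), G M j i)) ?A"
      proof (rule inj_onI, clarify)
        fix i j i' j'
        assume ij: "i \<in> {1..n}" "j \<in> {1..n}" "i' \<in> {1..n}" "j' \<in> {1..n}"
          and eq: "L (i, j) = L (i', j')" "G M j i = G M j' i'"
        \<comment> \<open>Equal pairs give equal entries in one column of \<open>M\<close>, which
          forces \<open>j = j'\<close>; column \<open>j\<close> of \<open>L\<close> then forces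
          \<open>i = i'\<close>.\<close>
        have "M (j, L (i, j)) = M (j', L (i, j))"
          using eq ij by (simp add: G_apply)
        moreover have "inj_on (\<lambda>l. M (l, L (i, j))) {1..n}"
          using M(1) latin_in_range[OF L ij(1,2)] by (simp add: latin_squares_iff bij_betw_def)
        ultimately have j: "j = j'"
          using ij by (meson inj_onD)
        moreover have "inj_on (\<lambda>i. L (i, j)) {1..n}"
          using L ij(2) by (simp add: latin_squares_iff bij_betw_def)
        ultimately show "i = i' \<and> j = j'"
          using ij eq(1) by (auto dest: inj_onD)
      qed
      show "(\<lambda>(i, j). (L (i, j), G M j i)) ` ?A \<subseteq> ?A"
        using latin_in_range[OF L] latin_in_range[OF M(1)] by (auto simp: G_apply)
    qed simp
    ultimately show ?thesis by simp
  qed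
  show ?thesis
  proof (rule sum.reindex_bij_witness[of _ G F])
    fix \<rho> assume \<rho>: "\<rho> \<in> ?T"
    then have \<rho>': "\<rho> \<in> Sym_tuples n" by simp
    show "F \<rho> \<in> ?S" by (rule F_in[OF \<rho>])
    show "G (F \<rho>) = \<rho>"
    proof
      fix j
      show "G (F \<rho>) j = \<rho> j"
      proof (cases "j \<in> {1..n}")
        case True
        then show ?thesis
          using permutes_inv_o(2)[OF c[OF True]]
          by (simp add: G_def F_row[OF \<rho>'] o_assoc[symmetric])
      next
        case False
        then show ?thesis
          using \<rho>' by (simp add: G_def Sym_tuples_def PiE_iff extensional_def)
      qed
    qed
    have "row_sign n (F \<rho>) = (\<Prod>j\<in>{1..n}. sign (\<rho> j) * sign (?c j))"
      unfolding row_sign_def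
      by (intro prod.cong refl) (simp add: F_row[OF \<rho>'] sign_comp_permutes[of "{1..n}"]
        sign_inv_permutes[of "{1..n}"] c permutes_inv Sym_tuples_permutes[OF \<rho>'])
    also have "\<dots> = tuple_sign n \<rho> * col_sign n L"
      by (simp add: prod.distrib tuple_sign_def col_sign_def)
    finally have "col_sign n L * row_sign n (F \<rho>) = tuple_sign n \<rho> * (col_sign n L * col_sign n L)"
      by simp
    also have "col_sign n L * col_sign n L = 1"
      by (simp add: col_sign_def flip: prod.distrib)
    finally show "col_sign n L * row_sign n (F \<rho>) = tuple_sign n \<rho>" by simp
  next
    fix M assume M: "M \<in> ?S"
    show "G M \<in> ?T" by (rule G_in[OF M])
    show "F (G M) = M"
    proof (rule latin_eqI[of _ n])
      show "F (G M) \<in> latin_squares n"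
        using F_in[OF G_in[OF M]] by simp
      fix j m assume jm: "j \<in> {1..n}" "m \<in> {1..n}"
      then show "F (G M) (j, m) = M (j, m)"
        using permutes_inverses(1)[OF c[OF jm(1)]] by (simp add: F_def G_def row_perm_apply)
    qed (use M in simp)
  qed
qed

text \<open>A nonzero sum excludes repetitions in every column but the first by the cancellation
  above; the first column follows by counting symbols.\<close>

lemma array_Sym_tuples_latin:
  assumes \<sigma>: "\<sigma> \<in> Sym_tuples n"
    and nz: "(\<Sum>\<rho> | \<rho> \<in> Sym_tuples n \<and> \<rho> 1 = id \<and> cell_bij n (array n \<sigma>) \<rho>. tuple_sign n \<rho>) \<noteq> 0"
  shows "array n \<sigma> \<in> latin_squares n"
proof -
  have inj: "inj_on (\<lambda>i. \<sigma> i j) {1..n}" if j: "j \<in> {1..n}" "j \<noteq> 1" for j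
  proof (rule inj_onI, rule ccontr)
    fix a b assume "a \<in> {1..n}" "b \<in> {1..n}" "\<sigma> a j = \<sigma> b j" "a \<noteq> b"
    then show False
      using nz sum_tuple_sign_eq_0[OF j, of a b "array n \<sigma>"] j by simp
  qed
  have in_range: "\<sigma> i j \<in> {1..n}" if "i \<in> {1..n}" "j \<in> {1..n}" for i j
    using permutes_in_image[OF Sym_tuples_permutes[OF \<sigma> that(1)]] that(2) by blast
  have bij: "bij_betw (\<lambda>i. \<sigma> i j) {1..n} {1..n}" if "j \<in> {1..n}" "j \<noteq> 1" for j
    using inj[OF that] in_range that by (intro inj_on_imp_bij_betw_self) auto
  have "inj_on (\<lambda>i. \<sigma> i 1) {1..n}"
    using Sym_tuples_permutes[OF \<sigma>] bij by (rule inj_on_first_col)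
  then have "bij_betw (\<lambda>i. \<sigma> i j) {1..n} {1..n}" if "j \<in> {1..n}" for j
    using bij in_range that by (cases "j = 1") (auto intro!: inj_on_imp_bij_betw_self)
  then show ?thesis
    using permutes_imp_bij[OF Sym_tuples_permutes[OF \<sigma>]] by (intro array_latin)
qed

lemma signed_sum_eq:
  assumes "odd n"
  shows "(\<Sum>(\<rho>, \<sigma>) \<in> {(\<rho>, \<sigma>). \<rho> \<in> Sym_tuples n \<and> \<sigma> \<in> Sym_tuples n \<and> \<rho> 1 = id}.
      sign (\<sigma> 1) * tuple_sign n \<sigma> * tuple_sign n \<rho> *
      of_bool (bij_betw (\<lambda>(i, j). (\<sigma> i j, \<rho> j i)) ({1..n} \<times> {1..n}) ({1..n} \<times> {1..n})))
    = fact n * (fact (n - 1))\<^sup>2 * ((-1) ^ (n * (n - 1) div 2) * (AT n * (int (R_even n) - int (R_odd n))))"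
proof -
  have n: "n \<ge> 1"
    using odd_pos[OF assms] by simp
  then have one: "1 \<in> {1..n}"
    by (simp add: atLeastAtMost_iff)
  let ?T = "{\<rho>. \<rho> \<in> Sym_tuples n \<and> \<rho> 1 = id}"
  let ?good = "\<lambda>\<rho> \<sigma>. bij_betw (\<lambda>(i, j). (\<sigma> i j, \<rho> j i)) ({1..n} \<times> {1..n}) ({1..n} \<times> {1..n})"
  define g where "g L = (\<Sum>\<rho> | \<rho> \<in> Sym_tuples n \<and> \<rho> 1 = id \<and> cell_bij n L \<rho>. tuple_sign n \<rho>)" for L
  define h where "h \<sigma> = sign (\<sigma> 1) * tuple_sign n \<sigma> * g (array n \<sigma>)" for \<sigma> :: "nat \<Rightarrow> nat \<Rightarrow> nat"
  define F where "F = (\<Sum>M | M \<in> latin_squares n \<and> normalized n M. row_sign n M)"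
  have good: "?good \<rho> \<sigma> \<longleftrightarrow> cell_bij n (array n \<sigma>) \<rho>" for \<rho> \<sigma>
    unfolding cell_bij_def by (rule bij_betw_cong) auto
  have inner: "(\<Sum>\<rho>\<in>?T. sign (\<sigma> 1) * tuple_sign n \<sigma> * tuple_sign n \<rho> * of_bool (?good \<rho> \<sigma>)) = h \<sigma>" for \<sigma>
  proof -
    have "g (array n \<sigma>) = (\<Sum>\<rho>\<in>?T. tuple_sign n \<rho> * of_bool (?good \<rho> \<sigma>))"
      unfolding g_def by (rule sum.mono_neutral_cong_left) (auto simp: good)
    then show ?thesis
      by (simp only: h_def sum_distrib_left mult.assoc)
  qed
  have "(\<Sum>(\<rho>, \<sigma>) \<in> {(\<rho>, \<sigma>). \<rho> \<in> Sym_tuples n \<and> \<sigma> \<in> Sym_tuples n \<and> \<rho> 1 = id}.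
      sign (\<sigma> 1) * tuple_sign n \<sigma> * tuple_sign n \<rho> * of_bool (?good \<rho> \<sigma>))
    = (\<Sum>(\<rho>, \<sigma>) \<in> ?T \<times> Sym_tuples n.
      sign (\<sigma> 1) * tuple_sign n \<sigma> * tuple_sign n \<rho> * of_bool (?good \<rho> \<sigma>))"
    by (rule sum.cong) auto
  also have "\<dots> = (\<Sum>\<sigma>\<in>Sym_tuples n. h \<sigma>)"
    unfolding sum.cartesian_product[symmetric] inner[symmetric] by (rule sum.swap)
  \<comment> \<open>For a tuple whose array is not Latin, the inner sum over \<open>\<rho>\<close>
    vanishes.\<close>
  also have "\<dots> = (\<Sum>\<sigma> | \<sigma> \<in> Sym_tuples n \<and> array n \<sigma> \<in> latin_squares n. h \<sigma>)"
    by (rule sum.mono_neutral_right) (auto simp: h_def g_def dest: array_Sym_tuples_latin)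
  also have "\<dots> = (\<Sum>L\<in>latin_squares n. sign (row_perm n L 1) * row_sign n L * g L)"
  proof (rule sum.reindex_bij_witness[of _ "\<lambda>L. \<lambda>i\<in>{1..n}. row_perm n L i" "array n"])
    fix \<sigma> assume "\<sigma> \<in> {\<sigma>. \<sigma> \<in> Sym_tuples n \<and> array n \<sigma> \<in> latin_squares n}"
    then have \<sigma>: "\<sigma> \<in> Sym_tuples n" and L: "array n \<sigma> \<in> latin_squares n"
      by auto
    have row: "row_perm n (array n \<sigma>) i = \<sigma> i" if "i \<in> {1..n}" for i
      using that by (intro row_perm_eqI Sym_tuples_permutes[OF \<sigma>]) auto
    show "array n \<sigma> \<in> latin_squares n" by fact
    show "(\<lambda>i\<in>{1..n}. row_perm n (array n \<sigma>) i) = \<sigma>"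
    proof
      fix i
      show "(\<lambda>i\<in>{1..n}. row_perm n (array n \<sigma>) i) i = \<sigma> i"
        using \<sigma> row by (cases "i \<in> {1..n}") (auto simp: Sym_tuples_def PiE_iff extensional_def)
    qed
    have "row_sign n (array n \<sigma>) = tuple_sign n \<sigma>"
      unfolding row_sign_def tuple_sign_def by (intro prod.cong) (auto simp: row)
    then show "sign (row_perm n (array n \<sigma>) 1) * row_sign n (array n \<sigma>) * g (array n \<sigma>) = h \<sigma>"
      by (simp add: h_def row[OF one])
  next
    fix L assume L: "L \<in> latin_squares n"
    have arr: "array n (\<lambda>i\<in>{1..n}. row_perm n L i) = L"
      using L by (auto simp: array_def latin_squares_iff extensional_def fun_eq_iff row_perm_apply)
    then show "array n (\<lambda>i\<in>{1..n}. row_perm n L i) = L" .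
    show "(\<lambda>i\<in>{1..n}. row_perm n L i) \<in> {\<sigma>. \<sigma> \<in> Sym_tuples n \<and> array n \<sigma> \<in> latin_squares n}"
      using L arr row_perm_permutes[OF L] by (simp add: Sym_tuples_def Sym_def)
  qed
  also have "\<dots> = (\<Sum>L\<in>latin_squares n.
      sign (row_perm n L 1) * sign (col_perm n L 1) * latin_sign n L * F)"
  proof (rule sum.cong[OF refl])
    fix L assume L: "L \<in> latin_squares n"
    have c: "col_perm n L 1 permutes {1..n}"
      using L one by (rule col_perm_permutes)
    \<comment> \<open>The first row \<open>inv (c 1)\<close> prescribed for \<open>M\<close> costs
      only its sign. What remains is \<open>F\<close>, which does not depend on \<open>L\<close>, so
      the double sum factors.\<close>
    have "g L = col_sign n L * (sign (inv (col_perm n L 1)) * F)"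
      unfolding g_def sum_tuple_sign_latin[OF L n] F_def
        sum_row_sign_first_row[OF assms permutes_inv[OF c], symmetric]
      by (simp add: sum_distrib_left)
    also have "sign (inv (col_perm n L 1)) = sign (col_perm n L 1)"
      using c by (intro sign_inv_permutes[of "{1..n}"]) auto
    finally show "sign (row_perm n L 1) * row_sign n L * g L
        = sign (row_perm n L 1) * sign (col_perm n L 1) * latin_sign n L * F"
      by (simp add: latin_sign_eq)
  qed
  also have "\<dots> = fact n * fact (n - 1) * (int (R_even n) - int (R_odd n)) * F"
    by (simp only: sum_distrib_right[symmetric] sum_sign_first_row_col[OF assms])
  also have "F = (-1) ^ (n * (n - 1) div 2) * fact (n - 1) * AT n"
    unfolding F_def using n by (rule sum_row_sign_normalized)
  finally show ?thesis
    by (simp only: power2_eq_square ac_simps)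
qed

theorem theorem7:
  fixes n :: nat
  assumes "odd n"
  shows "mcoeff
      (Const (1 / (fact n * (fact (n - 1))\<^sup>2) :: rat) *
        (\<Sum>(\<rho>, \<sigma>) \<in> {(\<rho>, \<sigma>). \<rho> \<in> Sym_tuples n \<and> \<sigma> \<in> Sym_tuples n \<and> \<rho> 1 = id}.
          of_int (sign (\<sigma> 1) * tuple_sign n \<sigma> * tuple_sign n \<rho>) *
          (\<Prod>i\<in>{1..n}. \<Prod>j\<in>{1..n}. Var (\<sigma> i j, \<rho> j i))))
      (all_ones_monomial n)
    = (-1) ^ (n * (n - 1) div 2) * of_int (AT n * (int (R_even n) - int (R_odd n)))"
proof -
  let ?S = "{(\<rho>, \<sigma>). \<rho> \<in> Sym_tuples n \<and> \<sigma> \<in> Sym_tuples n \<and> \<rho> 1 = id}"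
  have in_range: "(snd x i j, fst x j i) \<in> {1..n} \<times> {1..n}"
    if "x \<in> ?S" "i \<in> {1..n}" "j \<in> {1..n}" for x i j
    using that permutes_in_image[OF Sym_tuples_permutes[of "fst x" n j]]
      permutes_in_image[OF Sym_tuples_permutes[of "snd x" n i]] by auto
  let ?c = "fact n * (fact (n - 1))\<^sup>2 :: int"
  let ?r = "(-1) ^ (n * (n - 1) div 2) * (AT n * (int (R_even n) - int (R_odd n)))"
  have "(\<Sum>x\<in>?S. sign (snd x 1) * tuple_sign n (snd x) * tuple_sign n (fst x) *
      of_bool (bij_betw (\<lambda>(i, j). (snd x i j, fst x j i)) ({1..n} \<times> {1..n}) ({1..n} \<times> {1..n})))
    = ?c * ?r"
    using signed_sum_eq[OF assms] by (simp add: case_prod_unfold)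
  note coeff = mcoeff_sum_prod_Var[of ?S n "\<lambda>x i j. (snd x i j, fst x j i)"
        "1 / (fact n * (fact (n - 1))\<^sup>2)"
        "\<lambda>x. sign (snd x 1) * tuple_sign n (snd x) * tuple_sign n (fst x)", OF in_range, unfolded this]
  \<comment> \<open>One factor \<open>(n - 1)!\<close> comes from the sum over \<open>L\<close> and
    the other from \<open>F\<close>; the prefactor removes both together with
    \<open>n!\<close>.\<close>
  have "1 / (fact n * (fact (n - 1))\<^sup>2) * of_int (?c * ?r) = (of_int ?r :: rat)"
    by simp
  with coeff show ?thesis
    by (simp add: case_prod_unfold)
qed

end
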